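(* Let $R$ be a commutative ring and $a\in R$. Let $(T_R[x_1,x_3],d)$ be the free unital associative dg-$R$-algebra on generators of degrees $\deg(x_1)=1$, $\deg(x_3)=3$, with $d(x_1)=a$ and $d(x_3)=2x_1^2$. Let $(T_R[x,\hat x,r,y],d)$ be the free unital associative dg-$R$-algebra on generators of degrees $\deg(x)=\deg(\hat x)=1$, $\deg(r)=2$, $\deg(y)=3$, with $d(x)=d(\hat x)=a$, $d(r)=\hat x-x$, $d(y)=2x\hat x-2ar$. Then the map of dgas $$\psi\colon (T_R[x_1,x_3],d)\to (T_R[x,\hat x,r,y],d),\qquad x_1\mapsto x,\quad x_3\mapsto y+2xr,$$ is a weak equivalence (quasi-isomorphism).
   Context: The differentials are extended from generators by the graded Leibniz rule $d(uv)=d(u)v+(-1)^{\deg u}u\,d(v)$ and lower degree by one; $d(x_1)=a$ means $a$ times the unit. *)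

theory Defs
  imports "HOL-Library.Poly_Mapping" "HOL-Algebra.Coset"
begin

section \<open>Free unital associative algebras\<close>

text \<open>
  Commutative unital rings. Unlike \<open>comm_ring_1\<close>, this class does not impose \<open>0 \<noteq> 1\<close>, so the
  zero ring is included; \<open>semiring_numeral\<close> adds no axioms, only the notation for numerals.
  In return, \<open>('g, 'r) free_alg\<close> below is only an instance of \<open>ring\<close>, and its unit is \<open>unit_alg\<close>.
\<close>

class unital_comm_ring = comm_ring + comm_monoid_mult + semiring_numeral

subclass (in comm_ring_1) unital_comm_ring ..

datatype 'g free_word = Word (letters: "'g list")

instantiation free_word :: (type) monoid_add
begin

definition zero_free_word :: "'a free_word" where
  "0 = Word []"

definition plus_free_word :: "'a free_word \<Rightarrow> 'a free_word \<Rightarrow> 'a free_word" where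
  "u + v = Word (letters u @ letters v)"

instance
  by intro_classes (simp_all add: zero_free_word_def plus_free_word_def)

end

text \<open>
  The free algebra is the monoid algebra of the free monoid: finitely supported functions from
  words to coefficients. The library's product on \<open>\<Rightarrow>\<^sub>0\<close> is convolution along \<open>+\<close> on the index
  type, here concatenation of words.
\<close>

type_synonym ('g, 'r) free_alg = "'g free_word \<Rightarrow>\<^sub>0 'r"

definition unit_alg :: "('g, 'r::unital_comm_ring) free_alg" where
  "unit_alg = Poly_Mapping.single 0 1"

definition gen :: "'g \<Rightarrow> ('g, 'r::unital_comm_ring) free_alg" where
  "gen g = Poly_Mapping.single (Word [g]) 1"

definition scale :: "'r::unital_comm_ring \<Rightarrow> ('g, 'r) free_alg \<Rightarrow> ('g, 'r) free_alg"
    (infixr \<open>*\<^sub>a\<close> 75) where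
  "c *\<^sub>a p = Poly_Mapping.single 0 c * p"

definition word_deg :: "('g \<Rightarrow> nat) \<Rightarrow> 'g free_word \<Rightarrow> nat" where
  "word_deg deg w = sum_list (map deg (letters w))"

definition homog :: "('g \<Rightarrow> nat) \<Rightarrow> int \<Rightarrow> ('g, 'r::unital_comm_ring) free_alg set" where
  "homog deg n = {p. \<forall>w \<in> Poly_Mapping.keys p. int (word_deg deg w) = n}"

definition lin_ext ::
    "('g free_word \<Rightarrow> ('h, 'r::unital_comm_ring) free_alg) \<Rightarrow> ('g, 'r) free_alg \<Rightarrow> ('h, 'r) free_alg"
  where
  "lin_ext f p = (\<Sum>w \<in> Poly_Mapping.keys p. Poly_Mapping.lookup p w *\<^sub>a f w)"

definition alg_ext ::
    "('g \<Rightarrow> ('h, 'r::unital_comm_ring) free_alg) \<Rightarrow> ('g, 'r) free_alg \<Rightarrow> ('h, 'r) free_alg"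
  where
  "alg_ext \<phi> = lin_ext (\<lambda>w. foldr (\<lambda>g p. \<phi> g * p) (letters w) unit_alg)"

text \<open>
  Extension of values on generators by the graded Leibniz rule, peeling off the first letter:
  \<open>d(g w) = d(g) w + (-1)^deg(g) g d(w)\<close>.
\<close>

primrec word_deriv ::
    "('g \<Rightarrow> nat) \<Rightarrow> ('g \<Rightarrow> ('g, 'r::unital_comm_ring) free_alg) \<Rightarrow> 'g list \<Rightarrow> ('g, 'r) free_alg"
  where
  "word_deriv deg \<delta> [] = 0"
| "word_deriv deg \<delta> (g # ws) =
     \<delta> g * Poly_Mapping.single (Word ws) 1
     + (if even (deg g) then gen g else - gen g) * word_deriv deg \<delta> ws"

definition deriv_ext ::
    "('g \<Rightarrow> nat) \<Rightarrow> ('g \<Rightarrow> ('g, 'r::unital_comm_ring) free_alg) \<Rightarrow> ('g, 'r) free_alg \<Rightarrow> ('g, 'r) free_alg"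
  where
  "deriv_ext deg \<delta> = lin_ext (\<lambda>w. word_deriv deg \<delta> (letters w))"


section \<open>Differential graded structure and homology\<close>

definition is_dga ::
    "('g \<Rightarrow> nat) \<Rightarrow> (('g, 'r::unital_comm_ring) free_alg \<Rightarrow> ('g, 'r) free_alg) \<Rightarrow> bool"
  where
  "is_dga deg d \<longleftrightarrow>
     (\<forall>p q. d (p + q) = d p + d q) \<and>
     (\<forall>c p. d (c *\<^sub>a p) = c *\<^sub>a d p) \<and>
     (\<forall>n. d ` homog deg n \<subseteq> homog deg (n - 1)) \<and>
     (\<forall>n u v. u \<in> homog deg n \<longrightarrow> d (u * v) = d u * v + (if even n then u else - u) * d v) \<and>
     (\<forall>p. d (d p) = 0)"

definition is_dga_map ::
    "('g \<Rightarrow> nat) \<Rightarrow> (('g, 'r::unital_comm_ring) free_alg \<Rightarrow> ('g, 'r) free_alg) \<Rightarrow>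
     ('h \<Rightarrow> nat) \<Rightarrow> (('h, 'r) free_alg \<Rightarrow> ('h, 'r) free_alg) \<Rightarrow>
     (('g, 'r) free_alg \<Rightarrow> ('h, 'r) free_alg) \<Rightarrow> bool"
  where
  "is_dga_map degA dA degB dB f \<longleftrightarrow>
     (\<forall>p q. f (p + q) = f p + f q) \<and>
     (\<forall>c p. f (c *\<^sub>a p) = c *\<^sub>a f p) \<and>
     (\<forall>p q. f (p * q) = f p * f q) \<and>
     f unit_alg = unit_alg \<and>
     (\<forall>n. f ` homog degA n \<subseteq> homog degB n) \<and>
     (\<forall>p. f (dA p) = dB (f p))"

definition cycle_group ::
    "('g \<Rightarrow> nat) \<Rightarrow> (('g, 'r::unital_comm_ring) free_alg \<Rightarrow> ('g, 'r) free_alg) \<Rightarrow>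
     int \<Rightarrow> ('g, 'r) free_alg monoid"
  where
  "cycle_group deg d n = \<lparr>carrier = {p \<in> homog deg n. d p = 0}, monoid.mult = (+), one = 0\<rparr>"

definition boundaries ::
    "('g \<Rightarrow> nat) \<Rightarrow> (('g, 'r::unital_comm_ring) free_alg \<Rightarrow> ('g, 'r) free_alg) \<Rightarrow>
     int \<Rightarrow> ('g, 'r) free_alg set"
  where
  "boundaries deg d n = d ` homog deg (n + 1)"

definition homology ::
    "('g \<Rightarrow> nat) \<Rightarrow> (('g, 'r::unital_comm_ring) free_alg \<Rightarrow> ('g, 'r) free_alg) \<Rightarrow>
     int \<Rightarrow> ('g, 'r) free_alg set monoid"
  where
  "homology deg d n = cycle_group deg d n Mod boundaries deg d n"

text \<open>
  The induced map \<open>[z] \<mapsto> [f z]\<close>; for a chain map \<open>f\<close> all cosets in the union coincide.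
\<close>

definition homology_map ::
    "('h \<Rightarrow> nat) \<Rightarrow> (('h, 'r::unital_comm_ring) free_alg \<Rightarrow> ('h, 'r) free_alg) \<Rightarrow>
     int \<Rightarrow> (('g, 'r) free_alg \<Rightarrow> ('h, 'r) free_alg) \<Rightarrow>
     ('g, 'r) free_alg set \<Rightarrow> ('h, 'r) free_alg set"
  where
  "homology_map degB dB n f C = (\<Union>z\<in>C. boundaries degB dB n #>\<^bsub>cycle_group degB dB n\<^esub> f z)"

text \<open>
  As \<open>f\<close> is linear over the coefficient ring, so is each induced map; hence an isomorphism of
  the underlying homology groups is an isomorphism of homology modules.
\<close>

definition quasi_isomorphism ::
    "('g \<Rightarrow> nat) \<Rightarrow> (('g, 'r::unital_comm_ring) free_alg \<Rightarrow> ('g, 'r) free_alg) \<Rightarrow>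
     ('h \<Rightarrow> nat) \<Rightarrow> (('h, 'r) free_alg \<Rightarrow> ('h, 'r) free_alg) \<Rightarrow>
     (('g, 'r) free_alg \<Rightarrow> ('h, 'r) free_alg) \<Rightarrow> bool"
  where
  "quasi_isomorphism degA dA degB dB f \<longleftrightarrow>
     is_dga_map degA dA degB dB f \<and>
     (\<forall>n. homology_map degB dB n f \<in> iso (homology degA dA n) (homology degB dB n))"


section \<open>The two algebras and the map between them\<close>

datatype gens_A = X1 | X3

datatype gens_B = X | X_hat | R | Y

fun deg_A :: "gens_A \<Rightarrow> nat" where
  "deg_A X1 = 1"
| "deg_A X3 = 3"

fun deg_B :: "gens_B \<Rightarrow> nat" where
  "deg_B X = 1"
| "deg_B X_hat = 1"
| "deg_B R = 2"
| "deg_B Y = 3"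

fun d_gen_A :: "'r::unital_comm_ring \<Rightarrow> gens_A \<Rightarrow> (gens_A, 'r) free_alg" where
  "d_gen_A a X1 = a *\<^sub>a unit_alg"
| "d_gen_A a X3 = 2 *\<^sub>a (gen X1 * gen X1)"

fun d_gen_B :: "'r::unital_comm_ring \<Rightarrow> gens_B \<Rightarrow> (gens_B, 'r) free_alg" where
  "d_gen_B a X = a *\<^sub>a unit_alg"
| "d_gen_B a X_hat = a *\<^sub>a unit_alg"
| "d_gen_B a R = gen X_hat - gen X"
| "d_gen_B a Y = 2 *\<^sub>a (gen X * gen X_hat) - (2 * a) *\<^sub>a gen R"

definition d_A :: "'r::unital_comm_ring \<Rightarrow> (gens_A, 'r) free_alg \<Rightarrow> (gens_A, 'r) free_alg" where
  "d_A a = deriv_ext deg_A (d_gen_A a)"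

definition d_B :: "'r::unital_comm_ring \<Rightarrow> (gens_B, 'r) free_alg \<Rightarrow> (gens_B, 'r) free_alg" where
  "d_B a = deriv_ext deg_B (d_gen_B a)"

fun psi_gen :: "gens_A \<Rightarrow> (gens_B, 'r::unital_comm_ring) free_alg" where
  "psi_gen X1 = gen X"
| "psi_gen X3 = gen Y + 2 *\<^sub>a (gen X * gen R)"

definition psi :: "(gens_A, 'r::unital_comm_ring) free_alg \<Rightarrow> (gens_B, 'r) free_alg" where
  "psi = alg_ext psi_gen"

end

(* Sending x and x_hat to x_1, r to 0 and y to x_3 defines a dga map phi with phi psi = id. The
   degree 1 map h with h(uv) = h(u) v + (-1)^deg(u) psi(phi(u)) h(v), h(x_hat) = r and h = 0 on
   the other generators satisfies dh + hd = id - psi phi: both sides are compatible with products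
   in the same way, so this needs to be checked on generators only. Hence psi is a homotopy
   equivalence. *)

theory Submission
  imports Defs
begin

section \<open>Monomials, induction on elements and the scalar action\<close>

abbreviation mon :: "'g list \<Rightarrow> ('g, 'r::unital_comm_ring) free_alg" where
  "mon ws \<equiv> Poly_Mapping.single (Word ws) 1"

lemma unit_alg_eq_mon: "unit_alg = mon []"
  by (simp add: unit_alg_def zero_free_word_def)

lemma mon_append: "mon (u @ v) = mon u * mon v"
  by (simp add: mult_single plus_free_word_def)

lemma mon_Cons: "mon (g # ws) = gen g * mon ws"
  by (simp add: gen_def mult_single plus_free_word_def)

text \<open>The key in the update step is fresh, so updating amounts to adding a single term.
  Additive statements thus need checking only on one word with a coefficient.\<close>

lemma free_alg_induct [case_names single add]:
  fixes p :: "('g, 'r::unital_comm_ring) free_alg"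
  assumes "\<And>w c. P (Poly_Mapping.single w c)"
    and "\<And>p q. P p \<Longrightarrow> P q \<Longrightarrow> P (p + q)"
  shows "P p"
proof (induction p rule: update_induct)
  case const
  show ?case using assms(1)[of 0 0] by simp
next
  case (update p w c)
  have "Poly_Mapping.update w c p = p + Poly_Mapping.single w c"
    using update.hyps
    by (intro poly_mapping_eqI)
      (auto simp: lookup_update lookup_add lookup_single when_def in_keys_iff)
  then show ?case using assms update.IH by simp
qed

text \<open>The free algebra is only of class \<open>ring\<close>; the unit laws for
  \<open>unit_alg\<close> come from the empty word being neutral for concatenation.\<close>

lemma unit_alg_mult [simp]: "unit_alg * p = p" "p * unit_alg = p"
  by (induction p rule: free_alg_induct)
    (simp_all add: unit_alg_def mult_single distrib_left distrib_right)

text \<open>Scalars are central: the empty word commutes with every word, and coefficients commute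
  with each other.\<close>

lemma single_zero_commute:
  fixes p :: "('g, 'r::unital_comm_ring) free_alg"
  shows "p * Poly_Mapping.single 0 c = Poly_Mapping.single 0 c * p"
  by (induction p rule: free_alg_induct)
    (simp_all add: mult_single distrib_left distrib_right mult.commute)

lemma scale_add [simp]: "c *\<^sub>a (p + q) = c *\<^sub>a p + c *\<^sub>a q"
  by (simp add: scale_def distrib_left)

lemma scale_diff [simp]: "c *\<^sub>a (p - q) = c *\<^sub>a p - c *\<^sub>a q"
  by (simp add: scale_def right_diff_distrib)

lemma scale_minus [simp]: "c *\<^sub>a (- p) = - (c *\<^sub>a p)"
  by (simp add: scale_def)

lemma scale_zero [simp]: "c *\<^sub>a 0 = 0" "0 *\<^sub>a p = 0"
  by (simp_all add: scale_def)

lemma add_scale: "(b + c) *\<^sub>a p = b *\<^sub>a p + c *\<^sub>a p"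
  by (simp add: scale_def distrib_right single_add)

lemma scale_scale: "b *\<^sub>a c *\<^sub>a p = (b * c) *\<^sub>a p"
  by (simp add: scale_def mult.assoc[symmetric] mult_single)

lemma scale_one [simp]: "1 *\<^sub>a p = p"
  using unit_alg_mult(1)[of p] by (simp add: scale_def unit_alg_def)

lemma two_scale: "2 *\<^sub>a p = p + p"
  by (metis add_scale one_add_one scale_one)

lemma scale_mult_left [simp]: "(c *\<^sub>a p) * q = c *\<^sub>a (p * q)"
  by (simp add: scale_def mult.assoc)

lemma scale_mult_right [simp]: "p * (c *\<^sub>a q) = c *\<^sub>a (p * q)"
  by (simp add: scale_def mult.assoc[symmetric] single_zero_commute)

lemma single_eq_scale_mon: "Poly_Mapping.single w c = c *\<^sub>a mon (letters w)"
  by (simp add: scale_def mult_single)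

section \<open>Linear maps between free algebras\<close>

definition linear_alg ::
    "(('g, 'r::unital_comm_ring) free_alg \<Rightarrow> ('h, 'r) free_alg) \<Rightarrow> bool" where
  "linear_alg f \<longleftrightarrow> (\<forall>p q. f (p + q) = f p + f q) \<and> (\<forall>c p. f (c *\<^sub>a p) = c *\<^sub>a f p)"

lemma
  assumes "linear_alg f"
  shows linear_alg_add: "f (p + q) = f p + f q"
    and linear_alg_scale: "f (c *\<^sub>a p) = c *\<^sub>a f p"
    and linear_alg_zero: "f 0 = 0"
    and linear_alg_minus: "f (- p) = - f p"
    and linear_alg_diff: "f (p - q) = f p - f q"
proof -
  show add: "f (p + q) = f p + f q" for p q
    using assms by (simp add: linear_alg_def)
  show scale: "f (c *\<^sub>a p) = c *\<^sub>a f p" for c p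
    using assms by (simp add: linear_alg_def)
  show zero: "f 0 = 0" using scale[of 0 0] by simp
  show minus: "f (- p) = - f p" for p
    using add[of p "- p"] zero by (simp add: eq_neg_iff_add_eq_0 add.commute)
  show "f (p - q) = f p - f q"
    using add[of p "- q"] minus by simp
qed

lemma linear_alg_id [simp]: "linear_alg (\<lambda>p. p)"
  by (simp add: linear_alg_def)

lemma linear_alg_null: "linear_alg (\<lambda>p. 0)"
  by (simp add: linear_alg_def)

lemma linear_alg_compose: "linear_alg f \<Longrightarrow> linear_alg g \<Longrightarrow> linear_alg (\<lambda>p. f (g p))"
  by (simp add: linear_alg_def)

text \<open>Closure rules stated for abstractions, so that simplification can certify that both
  sides of an identity are linear in one argument, as \<open>linear_alg_eqI\<close>
  requires.\<close>

lemma
  assumes "linear_alg f"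
  shows linear_alg_uminus [simp]: "linear_alg (\<lambda>p. - f p)"
    and linear_alg_mult_left [simp]: "linear_alg (\<lambda>p. q * f p)"
    and linear_alg_mult_right [simp]: "linear_alg (\<lambda>p. f p * q)"
  using assms by (simp_all add: linear_alg_def distrib_left distrib_right)

lemma
  assumes "linear_alg f" "linear_alg g"
  shows linear_alg_plus [simp]: "linear_alg (\<lambda>p. f p + g p)"
    and linear_alg_sub [simp]: "linear_alg (\<lambda>p. f p - g p)"
  using assms by (simp_all add: linear_alg_def)

text \<open>The words span the free algebra. This reduces product identities to monomials, where
  induction on the letters is available.\<close>

lemma linear_alg_eqI:
  assumes "linear_alg f" "linear_alg g" "\<And>ws. f (mon ws) = g (mon ws)"
  shows "f p = g p"
proof (induction p rule: free_alg_induct)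
  case (single w c)
  show ?case
    by (subst (1 2) single_eq_scale_mon) (simp add: assms(3)[of "letters w", simplified] assms(1,2)[THEN linear_alg_scale])
next
  case (add p q)
  then show ?case by (simp add: assms(1,2)[THEN linear_alg_add])
qed

text \<open>Words outside the support contribute zero. A common index set makes sums over the
  supports of \<open>p\<close>, \<open>q\<close> and \<open>p + q\<close> comparable.\<close>

lemma lin_ext_superset:
  assumes "finite S" "Poly_Mapping.keys p \<subseteq> S"
  shows "lin_ext f p = (\<Sum>w\<in>S. Poly_Mapping.lookup p w *\<^sub>a f w)"
  unfolding lin_ext_def
  by (rule sum.mono_neutral_left) (use assms in \<open>auto simp: in_keys_iff\<close>)

lemma lookup_scale: "Poly_Mapping.lookup (c *\<^sub>a p) w = c * Poly_Mapping.lookup p w"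
  by (induction p rule: free_alg_induct)
    (simp_all add: scale_def mult_single lookup_add lookup_single when_def distrib_left)

lemma linear_alg_lin_ext: "linear_alg (lin_ext f)"
  unfolding linear_alg_def
proof (intro conjI allI)
  fix p q :: "('a, 'b) free_alg"
  let ?S = "Poly_Mapping.keys p \<union> Poly_Mapping.keys q"
  have "Poly_Mapping.keys (p + q) \<subseteq> ?S" by (rule keys_add)
  then show "lin_ext f (p + q) = lin_ext f p + lin_ext f q"
    by (simp add: lin_ext_superset[of ?S] lookup_add add_scale sum.distrib)
next
  fix c and p :: "('a, 'b) free_alg"
  have "Poly_Mapping.keys (c *\<^sub>a p) \<subseteq> Poly_Mapping.keys p"
    by (auto simp: in_keys_iff lookup_scale)
  then have "lin_ext f (c *\<^sub>a p) = (\<Sum>w\<in>Poly_Mapping.keys p. c *\<^sub>a Poly_Mapping.lookup p w *\<^sub>a f w)"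
    by (simp add: lin_ext_superset[of "Poly_Mapping.keys p"] lookup_scale scale_scale)
  then show "lin_ext f (c *\<^sub>a p) = c *\<^sub>a lin_ext f p"
    by (simp add: lin_ext_def scale_def sum_distrib_left)
qed

lemma lin_ext_mon [simp]: "lin_ext f (mon ws) = f (Word ws)"
  by (simp add: lin_ext_superset[of "{Word ws}"])

lemma linear_alg_alg_ext: "linear_alg (alg_ext \<phi>)"
  by (simp add: alg_ext_def linear_alg_lin_ext)

lemma alg_ext_unit [simp]: "alg_ext \<phi> unit_alg = unit_alg"
  unfolding alg_ext_def by (subst unit_alg_eq_mon) simp

lemma alg_ext_mon_Cons: "alg_ext \<phi> (mon (g # ws)) = \<phi> g * alg_ext \<phi> (mon ws)"
  by (simp add: alg_ext_def)

lemma alg_ext_gen [simp]: "alg_ext \<phi> (gen g) = \<phi> g"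
  by (simp add: alg_ext_def gen_def)

text \<open>Both sides are linear in each factor, so a pair of words suffices; there the first word
  is peeled off letter by letter.\<close>

lemma alg_ext_mult: "alg_ext \<phi> (p * q) = alg_ext \<phi> p * alg_ext \<phi> q"
proof (rule linear_alg_eqI[of "\<lambda>p. alg_ext \<phi> (p * q)"])
  fix u
  show "alg_ext \<phi> (mon u * q) = alg_ext \<phi> (mon u) * alg_ext \<phi> q"
  proof (rule linear_alg_eqI[of "\<lambda>q. alg_ext \<phi> (mon u * q)"])
    show "alg_ext \<phi> (mon u * mon v) = alg_ext \<phi> (mon u) * alg_ext \<phi> (mon v)" for v
      by (induction u)
        (simp_all add: mon_append[symmetric] alg_ext_mon_Cons mult.assoc flip: unit_alg_eq_mon)
  qed (simp_all add: linear_alg_compose[OF linear_alg_alg_ext] linear_alg_alg_ext)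
qed (simp_all add: linear_alg_compose[OF linear_alg_alg_ext] linear_alg_alg_ext)

lemmas alg_ext_add = linear_alg_add[OF linear_alg_alg_ext]
  and alg_ext_scale = linear_alg_scale[OF linear_alg_alg_ext]

lemma alg_ext_gen_id: "alg_ext gen p = p"
proof (rule linear_alg_eqI[where f = "alg_ext gen"])
  show "alg_ext gen (mon ws) = mon ws" for ws
    by (induction ws) (simp_all add: alg_ext_mult mon_Cons flip: unit_alg_eq_mon)
qed (simp_all add: linear_alg_alg_ext)

text \<open>Writing a linear map as a sum over the support of \<open>p\<close> exposes that only
  words of the degree of \<open>p\<close> matter when \<open>p\<close> is homogeneous.\<close>

lemma linear_alg_expand:
  assumes "linear_alg f"
  shows "f p = lin_ext (\<lambda>w. f (mon (letters w))) p"
  by (rule linear_alg_eqI) (simp_all add: assms linear_alg_lin_ext)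

section \<open>Homogeneous elements and the degree of linear maps\<close>

lemma mon_homog: "int (word_deg deg (Word ws)) = n \<Longrightarrow> mon ws \<in> homog deg n"
  by (simp add: homog_def)

lemma gen_homog: "int (deg g) = n \<Longrightarrow> gen g \<in> homog deg n"
  by (simp add: gen_def mon_homog word_deg_def)

lemma unit_alg_homog: "unit_alg \<in> homog deg 0"
  by (simp add: unit_alg_eq_mon mon_homog word_deg_def)

lemma homog_zero: "0 \<in> homog deg n"
  by (simp add: homog_def)

lemma homog_add: "p \<in> homog deg n \<Longrightarrow> q \<in> homog deg n \<Longrightarrow> p + q \<in> homog deg n"
  using keys_add[of p q] by (auto simp: homog_def)

lemma homog_minus: "p \<in> homog deg n \<Longrightarrow> - p \<in> homog deg n"
  by (simp add: homog_def)

lemma homog_diff: "p \<in> homog deg n \<Longrightarrow> q \<in> homog deg n \<Longrightarrow> p - q \<in> homog deg n"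
  using homog_add[of p deg n "- q"] homog_minus[of q] by simp

lemma homog_scale: "p \<in> homog deg n \<Longrightarrow> c *\<^sub>a p \<in> homog deg n"
  by (auto simp: homog_def in_keys_iff lookup_scale)

lemma homog_mult:
  assumes "p \<in> homog deg m" "q \<in> homog deg n"
  shows "p * q \<in> homog deg (m + n)"
  using assms keys_mult[of p q] by (fastforce simp: homog_def word_deg_def plus_free_word_def)

lemma homog_gen_mult: "int (deg g) + int (deg h) = n \<Longrightarrow> gen g * gen h \<in> homog deg n"
  using homog_mult[OF gen_homog[OF refl, of g deg] gen_homog[OF refl, of h deg]] by simp

lemma homog_sum: "(\<And>i. i \<in> I \<Longrightarrow> f i \<in> homog deg n) \<Longrightarrow> sum f I \<in> homog deg n"
  by (induction I rule: infinite_finite_induct) (simp_all add: homog_zero homog_add)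

lemma homog_letters:
  "p \<in> homog deg n \<Longrightarrow> w \<in> Poly_Mapping.keys p \<Longrightarrow> int (word_deg deg (Word (letters w))) = n"
  by (simp add: homog_def)

text \<open>Every word in the support of \<open>p\<close> has degree \<open>n\<close>, so a sign
  that varies with the word may be compared with a sign fixed by \<open>n\<close>.\<close>

lemma linear_alg_homog_eqI:
  assumes "linear_alg f" "linear_alg g" "p \<in> homog deg n"
    and "\<And>ws. int (word_deg deg (Word ws)) = n \<Longrightarrow> f (mon ws) = g (mon ws)"
  shows "f p = g p"
  using assms(4)[OF homog_letters[OF assms(3)]]
  by (subst linear_alg_expand[OF assms(1)], subst linear_alg_expand[OF assms(2)])
    (auto simp: lin_ext_def intro!: sum.cong)

text \<open>The integer \<open>k\<close> is the degree of \<open>f\<close>: 0 for algebra maps, -1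
  for differentials and 1 for the homotopy.\<close>

lemma linear_alg_homog:
  assumes "linear_alg f" "p \<in> homog deg n"
    and "\<And>ws. f (mon ws) \<in> homog deg' (int (word_deg deg (Word ws)) + k)"
  shows "f p \<in> homog deg' (n + k)"
  unfolding linear_alg_expand[OF assms(1), of p] lin_ext_def
proof (intro homog_sum homog_scale)
  fix w assume "w \<in> Poly_Mapping.keys p"
  then show "f (mon (letters w)) \<in> homog deg' (n + k)"
    using assms(3)[of "letters w"] homog_letters[OF assms(2)] by simp
qed

lemma alg_ext_homog:
  assumes "\<And>g. \<phi> g \<in> homog deg' (int (deg g))" "p \<in> homog deg n"
  shows "alg_ext \<phi> p \<in> homog deg' n"
proof -
  have "alg_ext \<phi> (mon ws) \<in> homog deg' (int (word_deg deg (Word ws)) + 0)" for ws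
  proof (induction ws)
    case Nil
    then show ?case by (simp add: word_deg_def unit_alg_homog flip: unit_alg_eq_mon)
  next
    case (Cons g ws)
    with homog_mult[OF assms(1)[of g]] show ?case
      by (fastforce simp: alg_ext_mon_Cons word_deg_def)
  qed
  from linear_alg_homog[OF linear_alg_alg_ext assms(2) this] show ?thesis by simp
qed

section \<open>Twisted derivations\<close>

text \<open>These are the values on generators of \<open>alg_ext \<phi>\<close> precomposed with the
  grading involution, which acts as (-1)^n in degree n.\<close>

definition koszul :: "('g \<Rightarrow> nat) \<Rightarrow> ('g \<Rightarrow> ('h, 'r::unital_comm_ring) free_alg) \<Rightarrow> 'g \<Rightarrow> ('h, 'r) free_alg"
  where "koszul deg \<phi> g = (if even (deg g) then \<phi> g else - \<phi> g)"

text \<open>The signs of the letters multiply along a word, and their product depends only on the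
  parity of the total degree.\<close>

lemma alg_ext_koszul:
  assumes "u \<in> homog deg n"
  shows "alg_ext (koszul deg \<phi>) u = (if even n then alg_ext \<phi> u else - alg_ext \<phi> u)"
proof (rule linear_alg_homog_eqI[OF linear_alg_alg_ext _ assms])
  show "linear_alg (\<lambda>u. if even n then alg_ext \<phi> u else - alg_ext \<phi> u)"
    by (cases "even n") (simp_all add: linear_alg_alg_ext)
  fix ws
  assume *: "int (word_deg deg (Word ws)) = n"
  have "alg_ext (koszul deg \<phi>) (mon ws) =
    (if even (word_deg deg (Word ws)) then alg_ext \<phi> (mon ws) else - alg_ext \<phi> (mon ws))"
    by (induction ws)
      (auto simp: alg_ext_mon_Cons word_deg_def koszul_def simp flip: unit_alg_eq_mon)
  then show "alg_ext (koszul deg \<phi>) (mon ws) =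
    (if even n then alg_ext \<phi> (mon ws) else - alg_ext \<phi> (mon ws))"
    using * by auto
qed

text \<open>
  Putting the Koszul sign into \<open>\<sigma>\<close> makes the Leibniz rule \<open>twisted_mult\<close> below hold for
  inhomogeneous factors too. The differentials have \<open>\<sigma> = koszul deg gen\<close>; a chain homotopy
  from \<open>alg_ext \<phi>\<close> to the identity has \<open>\<sigma> = koszul deg \<phi>\<close>.
\<close>

primrec twisted_word ::
    "('g \<Rightarrow> ('g, 'r::unital_comm_ring) free_alg) \<Rightarrow> ('g \<Rightarrow> ('g, 'r) free_alg) \<Rightarrow>
     'g list \<Rightarrow> ('g, 'r) free_alg"
  where
  "twisted_word \<sigma> \<eta> [] = 0"
| "twisted_word \<sigma> \<eta> (g # ws) = \<eta> g * mon ws + \<sigma> g * twisted_word \<sigma> \<eta> ws"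

definition twisted_deriv ::
    "('g \<Rightarrow> ('g, 'r::unital_comm_ring) free_alg) \<Rightarrow> ('g \<Rightarrow> ('g, 'r) free_alg) \<Rightarrow>
     ('g, 'r) free_alg \<Rightarrow> ('g, 'r) free_alg"
  where
  "twisted_deriv \<sigma> \<eta> = lin_ext (\<lambda>w. twisted_word \<sigma> \<eta> (letters w))"

text \<open>The sign in \<open>word_deriv\<close> is exactly the factor
  \<open>koszul deg gen g\<close>; differentials and homotopies thereby share one set of product and
  degree rules.\<close>

lemma deriv_ext_eq_twisted: "deriv_ext deg \<delta> = twisted_deriv (koszul deg gen) \<delta>"
proof -
  have "word_deriv deg \<delta> ws = twisted_word (koszul deg gen) \<delta> ws" for ws
    by (induction ws) (simp_all add: koszul_def)
  then show ?thesis by (simp add: deriv_ext_def twisted_deriv_def)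
qed

lemma linear_alg_twisted: "linear_alg (twisted_deriv \<sigma> \<eta>)"
  by (simp add: twisted_deriv_def linear_alg_lin_ext)

lemma twisted_mon_Nil: "twisted_deriv \<sigma> \<eta> (mon []) = 0"
  by (simp add: twisted_deriv_def)

lemma twisted_mon_Cons:
  "twisted_deriv \<sigma> \<eta> (mon (g # ws)) = \<eta> g * mon ws + \<sigma> g * twisted_deriv \<sigma> \<eta> (mon ws)"
  by (simp add: twisted_deriv_def)

lemma twisted_unit [simp]: "twisted_deriv \<sigma> \<eta> unit_alg = 0"
  by (simp add: unit_alg_eq_mon twisted_mon_Nil)

lemma twisted_gen [simp]: "twisted_deriv \<sigma> \<eta> (gen g) = \<eta> g"
  unfolding gen_def twisted_mon_Cons by (simp add: twisted_mon_Nil flip: unit_alg_eq_mon)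

text \<open>Linearity in \<open>p\<close> and then in \<open>q\<close> leaves two words. Induction
  on the first one unfolds both recursions, and associativity matches the terms.\<close>

lemma twisted_mult:
  "twisted_deriv \<sigma> \<eta> (p * q) = twisted_deriv \<sigma> \<eta> p * q + alg_ext \<sigma> p * twisted_deriv \<sigma> \<eta> q"
proof (rule linear_alg_eqI[of "\<lambda>p. twisted_deriv \<sigma> \<eta> (p * q)"])
  fix u
  let ?D = "twisted_deriv \<sigma> \<eta>"
  show "?D (mon u * q) = ?D (mon u) * q + alg_ext \<sigma> (mon u) * ?D q"
  proof (rule linear_alg_eqI[of "\<lambda>q. ?D (mon u * q)"])
    show "?D (mon u * mon v) = ?D (mon u) * mon v + alg_ext \<sigma> (mon u) * ?D (mon v)" for v
      by (induction u)
        (simp_all add: mon_append[symmetric] alg_ext_mon_Cons twisted_mon_Cons mult.assoc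
           distrib_left distrib_right add.assoc flip: unit_alg_eq_mon)
  qed (simp_all add: linear_alg_compose[OF linear_alg_twisted] linear_alg_twisted)
qed (simp_all add: linear_alg_compose[OF linear_alg_twisted] linear_alg_twisted linear_alg_alg_ext)

text \<open>Returns to the customary sign for a homogeneous left factor. For
  \<open>\<phi> = gen\<close> this is the graded Leibniz rule.\<close>

lemma twisted_mult_homog:
  assumes "p \<in> homog deg n"
  shows "twisted_deriv (koszul deg \<phi>) \<eta> (p * q) = twisted_deriv (koszul deg \<phi>) \<eta> p * q +
    (if even n then alg_ext \<phi> p else - alg_ext \<phi> p) * twisted_deriv (koszul deg \<phi>) \<eta> q"
  by (simp add: twisted_mult alg_ext_koszul[OF assms])

lemma koszul_homog: "\<phi> g \<in> homog deg' n \<Longrightarrow> koszul deg \<phi> g \<in> homog deg' n"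
  by (simp add: koszul_def homog_minus)

text \<open>Each term on a word applies \<open>\<eta>\<close> to exactly one letter and keeps the
  degrees of the others, so the shift \<open>k\<close> occurs once.\<close>

lemma twisted_homog:
  assumes "\<And>g. \<sigma> g \<in> homog deg (int (deg g))" "\<And>g. \<eta> g \<in> homog deg (int (deg g) + k)"
    "p \<in> homog deg n"
  shows "twisted_deriv \<sigma> \<eta> p \<in> homog deg (n + k)"
proof (rule linear_alg_homog[OF linear_alg_twisted assms(3)])
  show "twisted_deriv \<sigma> \<eta> (mon ws) \<in> homog deg (int (word_deg deg (Word ws)) + k)" for ws
  proof (induction ws)
    case Nil
    then show ?case by (simp add: twisted_mon_Nil homog_zero)
  next
    case (Cons g ws)
    have "\<eta> g * mon ws \<in> homog deg ((int (deg g) + k) + int (word_deg deg (Word ws)))"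
      by (intro homog_mult assms mon_homog refl)
    moreover have "\<sigma> g * twisted_deriv \<sigma> \<eta> (mon ws)
        \<in> homog deg (int (deg g) + (int (word_deg deg (Word ws)) + k))"
      by (intro homog_mult assms Cons.IH)
    ultimately show ?case
      by (simp add: twisted_mon_Cons word_deg_def homog_add algebra_simps)
  qed
qed

section \<open>Differentials, dga maps and homotopies determined by generators\<close>

lemma
  assumes "is_dga deg d"
  shows dga_linear: "linear_alg d"
    and dga_leibniz: "u \<in> homog deg n \<Longrightarrow> d (u * v) = d u * v + (if even n then u else - u) * d v"
    and dga_lower: "p \<in> homog deg n \<Longrightarrow> d p \<in> homog deg (n - 1)"
    and dga_square: "d (d p) = 0"
  using assms by (auto simp: is_dga_def linear_alg_def image_subset_iff)

lemma
  assumes "is_dga_map degA dA degB dB f"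
  shows dga_map_linear: "linear_alg f"
    and dga_map_homog: "p \<in> homog degA n \<Longrightarrow> f p \<in> homog degB n"
    and dga_map_commute: "f (dA p) = dB (f p)"
  using assms by (auto simp: is_dga_map_def linear_alg_def image_subset_iff)

text \<open>The Leibniz rule for the product of the unit with itself gives d(1) = d(1) +
  d(1).\<close>

lemma dga_unit: "is_dga deg d \<Longrightarrow> d unit_alg = 0"
  using dga_leibniz[of deg d unit_alg 0 unit_alg] by (simp add: unit_alg_homog)

text \<open>Degree and Leibniz rule are inherited from twisted derivations; the vanishing of the
  square spreads from generators to words.\<close>

lemma is_dga_deriv_ext:
  assumes homog: "\<And>g. \<delta> g \<in> homog deg (int (deg g) - 1)"
    and square: "\<And>g. deriv_ext deg \<delta> (\<delta> g) = 0"
  shows "is_dga deg (deriv_ext deg \<delta>)"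
proof -
  let ?d = "deriv_ext deg \<delta>"
  have lin: "linear_alg ?d" by (simp add: deriv_ext_eq_twisted linear_alg_twisted)
  have leibniz: "?d (u * v) = ?d u * v + (if even n then u else - u) * ?d v"
    if "u \<in> homog deg n" for n u v
    using twisted_mult_homog[OF that, of gen \<delta> v] by (simp add: deriv_ext_eq_twisted alg_ext_gen_id)
  have lower: "?d p \<in> homog deg (n - 1)" if "p \<in> homog deg n" for n p
    using twisted_homog[of "koszul deg gen" deg \<delta> "-1", OF _ _ that] homog
    by (simp add: deriv_ext_eq_twisted koszul_homog gen_homog)
  have "?d (?d p) = 0" for p
  proof (rule linear_alg_eqI[where f = "\<lambda>p. ?d (?d p)"])
    show "?d (?d (mon ws)) = 0" for ws
    proof (induction ws)
      case Nil
      show ?case by (simp add: deriv_ext_eq_twisted twisted_mon_Nil linear_alg_zero[OF linear_alg_twisted])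
    next
      case (Cons g ws)
      have "?d (mon (g # ws)) = \<delta> g * mon ws + koszul deg gen g * ?d (mon ws)"
        by (simp add: deriv_ext_eq_twisted twisted_mon_Cons)
      moreover have "?d (gen g) = \<delta> g" by (simp add: deriv_ext_eq_twisted)
      \<comment> \<open>Both Leibniz expansions yield the mixed term
        \<open>\<delta> g * ?d (mon ws)\<close>. The signs are opposite because the degrees of
        \<open>\<delta> g\<close> and \<open>g\<close> differ by one.\<close>
      ultimately show ?case
        using leibniz[OF homog, where v = "mon ws"] leibniz[OF gen_homog[OF refl], where v = "?d (mon ws)"]
        by (simp add: koszul_def linear_alg_add[OF lin] linear_alg_minus[OF lin] square Cons.IH)
    qed
  qed (simp_all add: linear_alg_compose[OF lin lin] linear_alg_null)
  then show ?thesis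
    unfolding is_dga_def
    using lin leibniz lower by (auto simp: linear_alg_def)
qed

text \<open>Both composites obey the same product rule: \<open>\<phi>\<close> preserves the degree
  of each generator, so the Leibniz signs on the two sides agree.\<close>

lemma is_dga_map_alg_ext:
  assumes dgaA: "is_dga degA (deriv_ext degA \<delta>A)" and dgaB: "is_dga degB dB"
    and homog: "\<And>g. \<phi> g \<in> homog degB (int (degA g))"
    and gens: "\<And>g. alg_ext \<phi> (\<delta>A g) = dB (\<phi> g)"
  shows "is_dga_map degA (deriv_ext degA \<delta>A) degB dB (alg_ext \<phi>)"
proof -
  let ?d = "deriv_ext degA \<delta>A" and ?f = "alg_ext \<phi>"
  note linA = dga_linear[OF dgaA] and linB = dga_linear[OF dgaB]
  have "?f (?d p) = dB (?f p)" for p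
  proof (rule linear_alg_eqI[where f = "\<lambda>p. ?f (?d p)" and g = "\<lambda>p. dB (?f p)"])
    show "?f (?d (mon ws)) = dB (?f (mon ws))" for ws
    proof (induction ws)
      case Nil
      show ?case
        by (simp add: deriv_ext_eq_twisted dga_unit[OF dgaB] linear_alg_zero[OF linear_alg_alg_ext] flip: unit_alg_eq_mon)
    next
      case (Cons g ws)
      have "dB (\<phi> g * q) = dB (\<phi> g) * q + (if even (degA g) then \<phi> g else - \<phi> g) * dB q" for q
        using dga_leibniz[OF dgaB homog, of g q] by simp
      with Cons.IH show ?case
        by (simp add: deriv_ext_eq_twisted twisted_mon_Cons alg_ext_mon_Cons alg_ext_add alg_ext_scale alg_ext_mult
            gens koszul_def linear_alg_minus[OF linear_alg_alg_ext])
    qed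
  qed (rule linear_alg_compose[OF linear_alg_alg_ext linA] linear_alg_compose[OF linB linear_alg_alg_ext])+
  then show ?thesis
    unfolding is_dga_map_def
    using alg_ext_homog[of \<phi> degB degA, OF homog] by (auto simp: alg_ext_add alg_ext_scale alg_ext_mult)
qed

text \<open>Writing f for \<open>alg_ext \<phi>\<close>, both sides D satisfy D(uv) = D(u) v + f(u)
  D(v). In dh + hd the terms with h(u) d(v) cancel by sign, and those with h(v) cancel because f(d
  u) = d(f u).\<close>

lemma twisted_homotopy:
  assumes dga: "is_dga deg (deriv_ext deg \<delta>)"
    and map: "is_dga_map deg (deriv_ext deg \<delta>) deg (deriv_ext deg \<delta>) (alg_ext \<phi>)"
    and \<eta>: "\<And>g. \<eta> g \<in> homog deg (int (deg g) + 1)"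
    and gens: "\<And>g. deriv_ext deg \<delta> (\<eta> g) + twisted_deriv (koszul deg \<phi>) \<eta> (\<delta> g) = gen g - \<phi> g"
  shows "deriv_ext deg \<delta> (twisted_deriv (koszul deg \<phi>) \<eta> p) +
    twisted_deriv (koszul deg \<phi>) \<eta> (deriv_ext deg \<delta> p) = p - alg_ext \<phi> p"
proof -
  let ?d = "deriv_ext deg \<delta>" and ?h = "twisted_deriv (koszul deg \<phi>) \<eta>" and ?f = "alg_ext \<phi>"
  have lin: "linear_alg ?d" "linear_alg ?h" "linear_alg ?f"
    by (simp_all add: deriv_ext_eq_twisted linear_alg_twisted linear_alg_alg_ext)
  note leibniz = dga_leibniz[OF dga]
  have dgen: "?d (gen g) = \<delta> g" for g by (simp add: deriv_ext_eq_twisted)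
  show ?thesis
  proof (rule linear_alg_eqI[where f = "\<lambda>p. ?d (?h p) + ?h (?d p)"])
    show "?d (?h (mon ws)) + ?h (?d (mon ws)) = mon ws - ?f (mon ws)" for ws
    proof (induction ws)
      case Nil
      show ?case
        by (simp add: deriv_ext_eq_twisted linear_alg_zero[OF linear_alg_twisted] flip: unit_alg_eq_mon)
    next
      case (Cons g ws)
      have \<phi>g: "\<phi> g \<in> homog deg (int (deg g))"
        using dga_map_homog[OF map gen_homog[OF refl, of g]] by simp
      have f\<delta>: "?f (\<delta> g) = ?d (\<phi> g)"
        using dga_map_commute[OF map, of "gen g"] by (simp add: dgen)
      have \<delta>g: "\<delta> g \<in> homog deg (int (deg g) - 1)"
        using dga_lower[OF dga gen_homog[OF refl, of g]] by (simp add: dgen)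
      \<comment> \<open>The induction hypothesis and the generator condition are solved for the term
        with the outer differential, to serve as rewrite rules in the final computation.\<close>
      have IH: "?d (?h (mon ws)) = mon ws - ?f (mon ws) - ?h (?d (mon ws))"
        using Cons.IH by (simp add: eq_diff_eq)
      have gens': "?d (\<eta> g) = gen g - \<phi> g - ?h (\<delta> g)"
        using gens[of g] by (simp add: eq_diff_eq)
      note eqs =
        twisted_mult_homog[OF gen_homog[OF refl, of g deg], of \<phi> \<eta> "mon ws"]
        twisted_mult_homog[OF gen_homog[OF refl, of g deg], of \<phi> \<eta> "?d (mon ws)"]
        twisted_mult_homog[OF \<delta>g, of \<phi> \<eta> "mon ws"]
        leibniz[OF gen_homog[OF refl, of g deg], where v = "mon ws"]
        leibniz[OF \<eta>[of g], where v = "mon ws"] leibniz[OF \<phi>g, where v = "?h (mon ws)"]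
      show ?case
        unfolding mon_Cons
        by (cases "even (deg g)")
          (simp_all add: eqs lin[THEN linear_alg_add] lin[THEN linear_alg_minus] lin[THEN linear_alg_diff]
            dgen alg_ext_mult IH gens' f\<delta> algebra_simps)
    qed
  qed (simp_all add: linear_alg_compose[OF lin(1,2)] linear_alg_compose[OF lin(2,1)] lin(3))
qed

section \<open>Homology of a homotopy retract\<close>

lemma carrier_cycle_group: "p \<in> carrier (cycle_group deg d n) \<longleftrightarrow> p \<in> homog deg n \<and> d p = 0"
  by (simp add: cycle_group_def)

lemma mult_cycle_group: "p \<otimes>\<^bsub>cycle_group deg d n\<^esub> q = p + q"
  by (simp add: cycle_group_def)

lemma one_cycle_group: "\<one>\<^bsub>cycle_group deg d n\<^esub> = 0"
  by (simp add: cycle_group_def)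

lemmas cycle_group_simps = carrier_cycle_group mult_cycle_group one_cycle_group

lemma comm_group_cycle_group:
  assumes "is_dga deg d"
  shows "comm_group (cycle_group deg d n)"
proof (rule comm_groupI)
  fix p
  assume "p \<in> carrier (cycle_group deg d n)"
  then have "- p \<in> carrier (cycle_group deg d n)"
    by (simp add: cycle_group_simps homog_minus linear_alg_minus[OF dga_linear[OF assms]])
  then show "\<exists>q\<in>carrier (cycle_group deg d n).
      q \<otimes>\<^bsub>cycle_group deg d n\<^esub> p = \<one>\<^bsub>cycle_group deg d n\<^esub>"
    by (intro bexI[of _ "- p"]) (simp_all add: cycle_group_simps)
qed (simp_all add: cycle_group_simps homog_add homog_zero linear_alg_add[OF dga_linear[OF assms]]
       linear_alg_zero[OF dga_linear[OF assms]] add_ac)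

lemma boundaries_zero: "is_dga deg d \<Longrightarrow> 0 \<in> boundaries deg d n"
  unfolding boundaries_def
  by (rule image_eqI[of _ _ 0]) (simp_all add: homog_zero linear_alg_zero[OF dga_linear])

lemma boundaries_add:
  assumes "is_dga deg d" "b \<in> boundaries deg d n" "c \<in> boundaries deg d n"
  shows "b + c \<in> boundaries deg d n"
  using assms(2,3) linear_alg_add[OF dga_linear[OF assms(1)], symmetric] homog_add
  unfolding boundaries_def by fastforce

lemma boundaries_minus:
  assumes "is_dga deg d" "b \<in> boundaries deg d n"
  shows "- b \<in> boundaries deg d n"
  using assms(2) linear_alg_minus[OF dga_linear[OF assms(1)], symmetric] homog_minus
  unfolding boundaries_def by fastforce

lemma boundaries_cycles:
  "is_dga deg d \<Longrightarrow> boundaries deg d n \<subseteq> carrier (cycle_group deg d n)"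
  using dga_lower[of deg d _ "n + 1"]
  by (auto simp: boundaries_def cycle_group_simps dga_square)

text \<open>Makes the quotient in \<open>homology\<close> a group. Subgroups of a commutative group
  are normal; closure under inverses needs the abstract inverse identified with negation.\<close>

lemma normal_boundaries:
  assumes "is_dga deg d"
  shows "boundaries deg d n \<lhd> cycle_group deg d n"
proof -
  interpret comm_group "cycle_group deg d n"
    by (rule comm_group_cycle_group[OF assms])
  have "inv\<^bsub>cycle_group deg d n\<^esub> b = - b" if "b \<in> boundaries deg d n" for b
    using that boundaries_minus[OF assms that] boundaries_cycles[OF assms]
    by (intro inv_equality) (auto simp: mult_cycle_group one_cycle_group)
  then have "subgroup (boundaries deg d n) (cycle_group deg d n)"
    using boundaries_zero[OF assms]
    by (intro subgroupI)
      (auto simp: boundaries_cycles assms boundaries_minus boundaries_add mult_cycle_group)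
  then show ?thesis by (rule subgroup_imp_normal)
qed

lemma r_coset_cycle_group: "N #>\<^bsub>cycle_group deg d n\<^esub> z = (\<lambda>b. b + z) ` N"
  by (auto simp: r_coset_def mult_cycle_group)

text \<open>For cycles this says that equal classes means homologous, the form in which
  well-definedness, injectivity and surjectivity are checked.\<close>

lemma boundaries_coset_eq_iff:
  assumes "is_dga deg d"
  shows "boundaries deg d n #>\<^bsub>cycle_group deg d n\<^esub> x = boundaries deg d n #>\<^bsub>cycle_group deg d n\<^esub> y
    \<longleftrightarrow> x - y \<in> boundaries deg d n"
proof
  let ?N = "boundaries deg d n"
  show "x - y \<in> ?N" if "?N #>\<^bsub>cycle_group deg d n\<^esub> x = ?N #>\<^bsub>cycle_group deg d n\<^esub> y"
  proof -
    have "0 + x \<in> (\<lambda>b. b + y) ` ?N"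
      using that boundaries_zero[OF assms] unfolding r_coset_cycle_group by blast
    then show ?thesis by auto
  qed
  have sub: "(\<lambda>b. b + u) ` ?N \<subseteq> (\<lambda>b. b + v) ` ?N" if "u - v \<in> ?N" for u v
  proof (rule image_subsetI)
    fix b assume "b \<in> ?N"
    then show "b + u \<in> (\<lambda>b. b + v) ` ?N"
      by (intro image_eqI[of _ _ "b + (u - v)"]) (simp_all add: boundaries_add assms that)
  qed
  show "?N #>\<^bsub>cycle_group deg d n\<^esub> x = ?N #>\<^bsub>cycle_group deg d n\<^esub> y" if "x - y \<in> ?N"
    using sub[of x y] sub[of y x] that boundaries_minus[OF assms that]
    unfolding r_coset_cycle_group by auto
qed

text \<open>A chain map sends boundaries to boundaries, so all members of the defining union agree.
  The union is not empty, since 0 is a boundary.\<close>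

lemma homology_map_coset:
  assumes A: "is_dga degA dA" and B: "is_dga degB dB" and f: "is_dga_map degA dA degB dB f"
  shows "homology_map degB dB n f (boundaries degA dA n #>\<^bsub>cycle_group degA dA n\<^esub> z) =
    boundaries degB dB n #>\<^bsub>cycle_group degB dB n\<^esub> f z"
proof -
  have "boundaries degB dB n #>\<^bsub>cycle_group degB dB n\<^esub> f (b + z) =
      boundaries degB dB n #>\<^bsub>cycle_group degB dB n\<^esub> f z"
    if "b \<in> boundaries degA dA n" for b
  proof -
    have "f b \<in> boundaries degB dB n"
      using that dga_map_homog[OF f] dga_map_commute[OF f] unfolding boundaries_def by auto
    then show ?thesis
      by (simp add: boundaries_coset_eq_iff[OF B] linear_alg_add[OF dga_map_linear[OF f]])
  qed
  then show ?thesis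
    using boundaries_zero[OF A] unfolding homology_map_def r_coset_cycle_group[where deg = degA] by auto
qed

text \<open>Injectivity: applying \<open>g\<close> to f(x - y) = d q exhibits x - y as the boundary
  of \<open>g q\<close>. Surjectivity: by the homotopy, a cycle z is homologous to f(g z).\<close>

lemma quasi_isomorphism_retract:
  assumes A: "is_dga degA dA" and B: "is_dga degB dB"
    and f: "is_dga_map degA dA degB dB f" and g: "is_dga_map degB dB degA dA g"
    and gf: "\<And>p. g (f p) = p"
    and h: "\<And>n p. p \<in> homog degB n \<Longrightarrow> h p \<in> homog degB (n + 1)" "h 0 = 0"
    and htpy: "\<And>p. dB (h p) + h (dB p) = p - f (g p)"
  shows "quasi_isomorphism degA dA degB dB f"
  unfolding quasi_isomorphism_def
proof (intro conjI allI f)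
  fix n
  let ?ZA = "cycle_group degA dA n" and ?ZB = "cycle_group degB dB n"
  let ?bA = "boundaries degA dA n" and ?bB = "boundaries degB dB n"
  let ?F = "homology_map degB dB n f"
  interpret NA: normal ?bA ?ZA by (rule normal_boundaries[OF A])
  interpret NB: normal ?bB ?ZB by (rule normal_boundaries[OF B])
  have carrier_A: "carrier (homology degA dA n) = (\<lambda>z. ?bA #>\<^bsub>?ZA\<^esub> z) ` carrier ?ZA"
    and carrier_B: "carrier (homology degB dB n) = (\<lambda>z. ?bB #>\<^bsub>?ZB\<^esub> z) ` carrier ?ZB"
    by (auto simp: homology_def FactGroup_def RCOSETS_def)
  have F: "?F (?bA #>\<^bsub>?ZA\<^esub> z) = ?bB #>\<^bsub>?ZB\<^esub> f z" for z
    by (rule homology_map_coset[OF A B f])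
  have f_cycle: "f z \<in> carrier ?ZB" if "z \<in> carrier ?ZA" for z
    using that dga_map_homog[OF f] dga_map_commute[OF f, of z, symmetric]
      linear_alg_zero[OF dga_map_linear[OF f]]
    by (simp add: cycle_group_simps)
  have g_cycle: "g z \<in> carrier ?ZA" if "z \<in> carrier ?ZB" for z
    using that dga_map_homog[OF g] dga_map_commute[OF g, of z, symmetric]
      linear_alg_zero[OF dga_map_linear[OF g]]
    by (simp add: cycle_group_simps)
  show "?F \<in> iso (homology degA dA n) (homology degB dB n)"
  proof (rule isoI)
    show "?F \<in> hom (homology degA dA n) (homology degB dB n)"
    proof (rule homI)
      fix C assume "C \<in> carrier (homology degA dA n)"
      then show "?F C \<in> carrier (homology degB dB n)"
        unfolding carrier_A carrier_B by (auto simp: F f_cycle)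
    next
      fix C D assume "C \<in> carrier (homology degA dA n)" "D \<in> carrier (homology degA dA n)"
      then obtain x y where xy: "x \<in> carrier ?ZA" "C = ?bA #>\<^bsub>?ZA\<^esub> x"
        "y \<in> carrier ?ZA" "D = ?bA #>\<^bsub>?ZA\<^esub> y"
        unfolding carrier_A by auto
      then show "?F (C \<otimes>\<^bsub>homology degA dA n\<^esub> D) = ?F C \<otimes>\<^bsub>homology degB dB n\<^esub> ?F D"
        using NA.rcos_sum[of x y] NB.rcos_sum[of "f x" "f y"]
        by (simp add: homology_def F f_cycle mult_cycle_group linear_alg_add[OF dga_map_linear[OF f]])
    qed
    show "bij_betw ?F (carrier (homology degA dA n)) (carrier (homology degB dB n))"
      unfolding bij_betw_def
    proof (intro conjI inj_onI)
      fix C D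
      assume "C \<in> carrier (homology degA dA n)" "D \<in> carrier (homology degA dA n)" "?F C = ?F D"
      then obtain x y where xy: "C = ?bA #>\<^bsub>?ZA\<^esub> x" "D = ?bA #>\<^bsub>?ZA\<^esub> y"
        and "f x - f y \<in> ?bB"
        unfolding carrier_A by (auto simp: F boundaries_coset_eq_iff[OF B])
      then obtain q where q: "q \<in> homog degB (n + 1)" "f (x - y) = dB q"
        by (auto simp: boundaries_def linear_alg_diff[OF dga_map_linear[OF f]])
      then have "x - y = dA (g q)"
        using gf[of "x - y"] dga_map_commute[OF g, of q] by simp
      then have "x - y \<in> ?bA"
        using dga_map_homog[OF g q(1)] by (simp add: boundaries_def)
      then show "C = D" by (simp add: xy boundaries_coset_eq_iff[OF A])
    next
      show "?F ` carrier (homology degA dA n) = carrier (homology degB dB n)"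
      proof
        show "?F ` carrier (homology degA dA n) \<subseteq> carrier (homology degB dB n)"
          unfolding carrier_A carrier_B by (auto simp: F f_cycle)
        show "carrier (homology degB dB n) \<subseteq> ?F ` carrier (homology degA dA n)"
          unfolding carrier_B
        proof (rule image_subsetI)
          fix z assume z: "z \<in> carrier ?ZB"
          \<comment> \<open>Since z is a cycle, the other term of the homotopy formula is
            \<open>h 0\<close>, which vanishes.\<close>
          then have "z - f (g z) = dB (h z)" "h z \<in> homog degB (n + 1)"
            using htpy[of z] h by (simp_all add: cycle_group_simps)
          then have "?bB #>\<^bsub>?ZB\<^esub> z = ?F (?bA #>\<^bsub>?ZA\<^esub> g z)"
            unfolding F boundaries_coset_eq_iff[OF B] by (simp add: boundaries_def)
          then show "?bB #>\<^bsub>?ZB\<^esub> z \<in> ?F ` carrier (homology degA dA n)"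
            unfolding carrier_A using g_cycle[OF z] by blast
        qed
      qed
    qed
  qed
qed

section \<open>The retraction and the homotopy\<close>

text \<open>The only computation is on x_3: as x_1 is odd, d(x_1^2) = a x_1 - a x_1 = 0.\<close>

lemma is_dga_A: "is_dga deg_A (d_A a)"
  unfolding d_A_def
proof (rule is_dga_deriv_ext)
  fix g
  show "d_gen_A a g \<in> homog deg_A (int (deg_A g) - 1)"
    by (cases g) (simp_all add: homog_scale homog_gen_mult unit_alg_homog)
  show "deriv_ext deg_A (d_gen_A a) (d_gen_A a g) = 0"
    by (cases g)
      (simp_all add: deriv_ext_eq_twisted linear_alg_scale[OF linear_alg_twisted] twisted_mult
        koszul_def)
qed

text \<open>On r the two copies of a cancel. On y, 2 d(x x_hat) = 2a (x_hat - x), which is 2a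
  d(r).\<close>

lemma is_dga_B: "is_dga deg_B (d_B a)"
  unfolding d_B_def
proof (rule is_dga_deriv_ext)
  fix g
  show "d_gen_B a g \<in> homog deg_B (int (deg_B g) - 1)"
    by (cases g) (simp_all add: homog_scale homog_gen_mult homog_diff unit_alg_homog gen_homog)
  show "deriv_ext deg_B (d_gen_B a) (d_gen_B a g) = 0"
    by (cases g)
      (simp_all add: deriv_ext_eq_twisted linear_alg_scale[OF linear_alg_twisted]
        linear_alg_diff[OF linear_alg_twisted] twisted_mult koszul_def scale_scale)
qed

fun retract_gen :: "gens_B \<Rightarrow> (gens_A, 'r::unital_comm_ring) free_alg" where
  "retract_gen X = gen X1"
| "retract_gen X_hat = gen X1"
| "retract_gen R = 0"
| "retract_gen Y = gen X3"

fun homotopy_gen :: "gens_B \<Rightarrow> (gens_B, 'r::unital_comm_ring) free_alg" where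
  "homotopy_gen X_hat = gen R"
| "homotopy_gen _ = 0"

text \<open>The correction 2xr in the image of x_3 contributes 2ar - 2x (x_hat - x); added to d(y) =
  2x x_hat - 2ar this leaves 2x^2.\<close>

lemma is_dga_map_psi: "is_dga_map deg_A (d_A a) deg_B (d_B a) psi"
  unfolding psi_def d_A_def
proof (rule is_dga_map_alg_ext)
  show "is_dga deg_A (deriv_ext deg_A (d_gen_A a))"
    using is_dga_A by (simp add: d_A_def)
  show "is_dga deg_B (d_B a)" by (rule is_dga_B)
  fix g
  show "psi_gen g \<in> homog deg_B (int (deg_A g))"
    by (cases g) (simp_all add: homog_scale homog_gen_mult homog_add gen_homog)
  show "alg_ext psi_gen (d_gen_A a g) = d_B a (psi_gen g)"
    by (cases g)
      (simp_all add: d_B_def deriv_ext_eq_twisted linear_alg_scale[OF linear_alg_twisted]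
        linear_alg_add[OF linear_alg_twisted] twisted_mult koszul_def scale_scale alg_ext_mult
        alg_ext_scale algebra_simps)
qed

text \<open>With x and x_hat identified and r sent to 0, d(r) goes to 0 and d(y) to 2 x_1^2.\<close>

lemma is_dga_map_retract: "is_dga_map deg_B (d_B a) deg_A (d_A a) (alg_ext retract_gen)"
  unfolding d_B_def
proof (rule is_dga_map_alg_ext)
  show "is_dga deg_B (deriv_ext deg_B (d_gen_B a))"
    using is_dga_B by (simp add: d_B_def)
  show "is_dga deg_A (d_A a)" by (rule is_dga_A)
  fix g
  show "retract_gen g \<in> homog deg_A (int (deg_B g))"
    by (cases g) (simp_all add: gen_homog homog_zero)
  show "alg_ext retract_gen (d_gen_B a g) = d_A a (retract_gen g)"
    by (cases g)
      (simp_all add: d_A_def deriv_ext_eq_twisted linear_alg_zero[OF linear_alg_twisted]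
        alg_ext_mult alg_ext_scale linear_alg_diff[OF linear_alg_alg_ext])
qed

lemma alg_ext_alg_ext: "alg_ext \<phi> (alg_ext \<psi> p) = alg_ext (\<lambda>g. alg_ext \<phi> (\<psi> g)) p"
proof (rule linear_alg_eqI[where f = "\<lambda>p. alg_ext \<phi> (alg_ext \<psi> p)"])
  show "alg_ext \<phi> (alg_ext \<psi> (mon ws)) = alg_ext (\<lambda>g. alg_ext \<phi> (\<psi> g)) (mon ws)" for ws
    by (induction ws) (simp_all add: alg_ext_mon_Cons alg_ext_mult flip: unit_alg_eq_mon)
qed (simp_all add: linear_alg_compose[OF linear_alg_alg_ext linear_alg_alg_ext] linear_alg_alg_ext)

text \<open>An algebra map is determined on generators. On x_3 the summand 2xr disappears because r
  is sent to 0.\<close>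

lemma retract_psi:
  fixes p :: "(gens_A, 'r::unital_comm_ring) free_alg"
  shows "alg_ext retract_gen (psi p) = p"
proof -
  have "alg_ext retract_gen (psi_gen g) = (gen g :: (gens_A, 'r) free_alg)" for g
    by (cases g) (simp_all add: alg_ext_add alg_ext_scale alg_ext_mult)
  then show ?thesis by (simp add: psi_def alg_ext_alg_ext alg_ext_gen_id)
qed

lemma is_dga_map_compose:
  assumes "is_dga_map degA dA degB dB f" "is_dga_map degB dB degC dC g"
  shows "is_dga_map degA dA degC dC (\<lambda>p. g (f p))"
  using assms by (simp add: is_dga_map_def image_subset_iff)

theorem proposition1p2:
  fixes a :: "'r::unital_comm_ring"
  shows "is_dga deg_A (d_A a) \<and> is_dga deg_B (d_B a) \<and>
         quasi_isomorphism deg_A (d_A a) deg_B (d_B a) psi"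
proof (intro conjI is_dga_A is_dga_B)
  \<comment> \<open>The composite of the retraction with \<open>psi\<close> is itself an algebra
    extension, with values \<open>\<rho>\<close> on generators. In this form it can serve as the
    twist of the homotopy.\<close>
  define \<rho> :: "gens_B \<Rightarrow> (gens_B, 'r) free_alg" where "\<rho> g = psi (retract_gen g)" for g
  have \<rho>: "psi (alg_ext retract_gen p) = alg_ext \<rho> p" for p :: "(gens_B, 'r) free_alg"
    by (simp add: psi_def alg_ext_alg_ext \<rho>_def[abs_def])
  have \<rho>_simps: "\<rho> X = gen X" "\<rho> X_hat = gen X" "\<rho> R = 0" "\<rho> Y = gen Y + 2 *\<^sub>a (gen X * gen R)"
    by (simp_all add: \<rho>_def psi_def linear_alg_zero[OF linear_alg_alg_ext])
  let ?h = "twisted_deriv (koszul deg_B \<rho>) homotopy_gen"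
  have \<eta>: "homotopy_gen g \<in> homog deg_B (int (deg_B g) + 1)" for g
    by (cases g) (simp_all add: homog_zero gen_homog)
  have map: "is_dga_map deg_B (d_B a) deg_B (d_B a) (alg_ext \<rho>)"
    using is_dga_map_compose[OF is_dga_map_retract is_dga_map_psi, of a] by (simp add: \<rho>)
  have \<rho>_homog: "\<rho> g \<in> homog deg_B (int (deg_B g))" for g
    using dga_map_homog[OF map gen_homog[OF refl, of g]] by simp
  \<comment> \<open>On x both sides vanish; on x_hat, d(r) = x_hat - x; on r, h(x_hat - x) = r. On y
    the odd degree of x gives h(2x x_hat) = -2xr, which is y - (y + 2xr).\<close>
  have gens: "d_B a (homotopy_gen g) + ?h (d_gen_B a g) = gen g - \<rho> g" for g
    by (cases g)
      (simp_all add: d_B_def deriv_ext_eq_twisted linear_alg_scale[OF linear_alg_twisted]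
        linear_alg_add[OF linear_alg_twisted] linear_alg_diff[OF linear_alg_twisted]
        linear_alg_zero[OF linear_alg_twisted]
        twisted_mult koszul_def \<rho>_simps two_scale add_scale scale_scale algebra_simps)
  show "quasi_isomorphism deg_A (d_A a) deg_B (d_B a) psi"
  proof (rule quasi_isomorphism_retract[OF is_dga_A is_dga_B is_dga_map_psi is_dga_map_retract])
    show "alg_ext retract_gen (psi p) = p" for p :: "(gens_A, 'r) free_alg"
      by (rule retract_psi)
    show "?h p \<in> homog deg_B (n + 1)" if "p \<in> homog deg_B n" for n p
      by (rule twisted_homog[OF koszul_homog[of \<rho>, OF \<rho>_homog] \<eta> that])
    show "?h 0 = 0" by (rule linear_alg_zero[OF linear_alg_twisted])
    show "d_B a (?h p) + ?h (d_B a p) = p - psi (alg_ext retract_gen p)" for p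
      unfolding \<rho> d_B_def
      by (rule twisted_homotopy) (use is_dga_B map \<eta> gens in \<open>simp_all add: d_B_def\<close>)
  qed
qed

end
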